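(* Let $N_x\ge3$, $N_\mu\ge1$, $\Delta x=1/N_x$, $\Delta t>0$, $\sigma\ge0$. Let $\mathbf v^0=(v_{jk}^0)\in\mathbb R^{N_x\times N_\mu}$ and $\mathbf B^0=(B_j^0)\in\mathbb R^{N_x}$ with all $B_j^0\ne0$, and let $\mathbf v^1=(v_{jk}^1)\in\mathbb R^{N_x\times N_\mu}$, $\mathbf B^1=(B_j^1)\in\mathbb R^{N_x}$ satisfy the fully discrete conservative form of the multiplicative Su-Olson problem, i.e. for all $j=1,\dots,N_x$, $k=0,\dots,N_\mu-1$, $$v_{jk}^1 = v_{jk}^0 - \Delta t \sum_{i=1}^{N_x} \sum_{\ell=0}^{N_\mu-1} \frac{1}{B_j^0} D_{ji}^x B_i^0 v_{i\ell}^0 A_{k\ell} + \Delta t \sum_{i=1}^{N_x} \sum_{\ell=0}^{N_\mu-1} \frac{1}{B_j^0} D_{ji}^{xx} B_i^0 v_{i\ell}^0 |A|_{k\ell} +\sigma \Delta t \frac{B_j^1}{B_j^0} \left(\sqrt{2}\, \delta_{k0} -v_{jk}^1 \right) - \Delta t \frac{1}{B_j^0} \frac{B_j^1-B_j^0}{\Delta t} v_{jk}^1,$$ $$B_j^1 = B_j^0 + \sigma \Delta t\, B_j^1 \left(\sqrt{2}\, v_{j0}^1 - 2 \right).$$ Under the time step restriction $\Delta t\le\Delta x$ this scheme is energy stable, i.e. $E^1\le E^0$, where for $n\in\{0,1\}$ $$E^n=\tfrac12\sum_{j=1}^{N_x}\sum_{k=0}^{N_\mu-1}\left(B_j^nv_{jk}^n\right)^2+\tfrac12\sum_{j=1}^{N_x}\left(B_j^n\right)^2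 .$$
   Context: Spatial indices $i,j$ run over $1,\dots,N_x$ (periodic grid), angular indices $k,\ell$ over $0,\dots,N_\mu-1$. Angular matrices: $P_\ell$ is the Legendre polynomial of degree $\ell$ normalized so that $\int_{-1}^1P_kP_\ell\,d\mu=\delta_{k\ell}$. $\mathbf A\in\mathbb R^{N_\mu\times N_\mu}$ has entries $A_{k\ell}=\int_{-1}^1 \mu P_k(\mu)P_\ell(\mu)\,d\mu$; it is symmetric, $\mathbf A=\mathbf Q\mathbf M\mathbf Q^\top$ with $\mathbf Q$ orthogonal and $\mathbf M$ diagonal, and $|\mathbf A|:=\mathbf Q|\mathbf M|\mathbf Q^\top$ (entries $|A|_{k\ell}$). Stencil matrices $\mathbf D^x,\mathbf D^{xx}\in\mathbb R^{N_x\times N_x}$ (periodic, i.e. indices modulo $N_x$): $D^x_{j,j\pm1}=\frac{\pm1}{2\Delta x}$, $D^{xx}_{j,j}=-\frac1{\Delta x}$, $D^{xx}_{j,j\pm1}=\frac1{2\Delta x}$, all other entries $0$; in particular $D^x_{1,N_x}=\frac{-1}{2\Delta x}$, $D^x_{N_x,1}=\frac1{2\Delta x}$, $D^{xx}_{1,N_x}=D^{xx}_{N_x,1}=\frac1{2\Delta x}$. *)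

theory Defs
  imports "HOL-Analysis.Analysis" "HOL-Computational_Algebra.Polynomial"
    "Jordan_Normal_Form.Matrix"
begin

(* Classical Legendre polynomial, by the Rodrigues formula (value 1 at the point 1). *)
definition legendre_poly :: "nat \<Rightarrow> real poly" where
  "legendre_poly n = Polynomial.smult (1 / (2 ^ n * fact n)) ((pderiv ^^ n) ([:-1, 0, 1:] ^ n))"

(* Rescaled to have norm 1 in L2(-1,1), so that the family is orthonormal. *)
definition normalized_legendre :: "nat \<Rightarrow> real poly" where
  "normalized_legendre n =
     Polynomial.smult (1 / sqrt (integral {-1..1} (\<lambda>x. (poly (legendre_poly n) x)\<^sup>2))) (legendre_poly n)"

definition angular_matrix :: "nat \<Rightarrow> real mat" where
  "angular_matrix N = Matrix.mat N N (\<lambda>(k, l).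
     integral {-1..1}
       (\<lambda>x. x * poly (normalized_legendre k) x * poly (normalized_legendre l) x))"

(* Stencil matrices are indexed by 1..N, with row index j and column index i. "Mod N"
   makes them periodic: row 1 has left neighbour N, and row N has right neighbour 1.
   For N >= 3 the cases below do not overlap. *)
definition stencil_x :: "nat \<Rightarrow> real \<Rightarrow> nat \<Rightarrow> nat \<Rightarrow> real" where
  "stencil_x N h j i =
     (if i mod N = (j + 1) mod N then 1 / (2 * h)
      else if (i + 1) mod N = j mod N then - 1 / (2 * h)
      else 0)"

definition stencil_xx :: "nat \<Rightarrow> real \<Rightarrow> nat \<Rightarrow> nat \<Rightarrow> real" where
  "stencil_xx N h j i =
     (if i = j then - 1 / h
      else if i mod N = (j + 1) mod N \<or> (i + 1) mod N = j mod N then 1 / (2 * h)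
      else 0)"

definition energy :: "nat \<Rightarrow> nat \<Rightarrow> (nat \<Rightarrow> nat \<Rightarrow> real) \<Rightarrow> (nat \<Rightarrow> real) \<Rightarrow> real" where
  "energy Nx N\<mu> v B =
     1 / 2 * (\<Sum>j = 1..Nx. \<Sum>k<N\<mu>. (B j * v j k)\<^sup>2) + 1 / 2 * (\<Sum>j = 1..Nx. (B j)\<^sup>2)"

end

(* In the conservative variables u = B v the scheme is an explicit upwind transport step
   followed by an implicit source step. The source step dissipates energy because its terms
   combine to a square. The transport step decouples in the eigenbasis of A into scalar upwind
   steps, which are convex combinations of neighbours as soon as the eigenvalues satisfy
   |a| dt/dx <= 1. Finally |a| <= 1, since an eigenvalue of A is the integral over [-1, 1] of
   x p(x)^2 for a combination p of orthonormal Legendre polynomials with unit norm. *)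

theory Submission
  imports Defs
begin

section \<open>Legendre polynomials and the spectral bound for the angular matrix\<close>

lemma has_integral_pderiv:
  fixes p :: "real poly"
  shows "(poly (pderiv p) has_integral (poly p 1 - poly p (-1))) {-1..1}"
  by (rule fundamental_theorem_of_calculus)
     (auto simp: has_real_derivative_iff_has_vector_derivative [symmetric]
        intro: DERIV_subset [OF poly_DERIV])

lemma poly_integrable [simp, intro]:
  fixes p :: "real poly"
  shows "poly p integrable_on {-1..1}"
  by (intro integrable_continuous_interval continuous_intros)

text \<open>Each differentiation costs at most one factor \<open>c\<close>. With \<open>c\<close> =
  x^2 - 1 this makes the boundary terms at -1 and 1 vanish in the integration by parts
  below.\<close>

lemma power_dvd_higher_pderiv:
  fixes c :: "real poly"
  shows "c ^ n dvd (pderiv ^^ m) (c ^ (n + m))"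
proof (induction m arbitrary: n)
  case (Suc m)
  from Suc[of "Suc n"] obtain r where "(pderiv ^^ m) (c ^ (Suc n + m)) = c ^ Suc n * r"
    by (auto elim: dvdE)
  then have "(pderiv ^^ Suc m) (c ^ (n + Suc m))
      = c ^ n * (c * pderiv r + r * Polynomial.smult (of_nat (Suc n)) (pderiv c))"
    by (simp only: funpow.simps o_apply add_Suc_right add_Suc pderiv_mult pderiv_power_Suc)
       (simp add: algebra_simps del: of_nat_Suc)
  then show ?case by (metis dvd_triv_left)
qed simp

text \<open>Repeated integration by parts moves the derivatives one at a time onto \<open>q\<close>
  until \<open>q\<close> has been differentiated to 0. The disjunct \<open>q = 0\<close> keeps the
  induction going: a constant has derivative 0, whose degree is also 0, and for \<open>m = 0\<close>
  only \<open>q = 0\<close> is left.\<close>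

lemma integral_higher_pderiv_times_lower_degree:
  fixes q :: "real poly"
  assumes "m \<le> n" "q = 0 \<or> degree q < m"
  shows "integral {-1..1} (poly ((pderiv ^^ m) ([:-1, 0, 1:] ^ n) * q)) = 0"
  using assms
proof (induction m arbitrary: q)
  case 0
  then show ?case by (auto simp: fun_eq_iff)
next
  case (Suc m)
  let ?W = "(pderiv ^^ m) ([:-1, 0, 1:] ^ n) :: real poly"
  have "([:-1, 0, 1:] :: real poly) ^ (n - m) dvd ?W"
    using power_dvd_higher_pderiv[of "[:-1, 0, 1:]" "n - m" m] Suc.prems(1) by simp
  then obtain r where r: "?W = [:-1, 0, 1:] ^ (n - m) * r" by (elim dvdE)
  \<comment> \<open>Only \<open>m < n\<close> derivatives have been taken, so the exponent
    \<open>n - m\<close> is positive and the factor x^2 - 1 survives.\<close>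
  have boundary: "poly ?W 1 = 0" "poly ?W (-1) = 0"
    using Suc.prems(1) unfolding r by (auto simp: poly_power zero_power)
  have "pderiv q = 0 \<or> degree (pderiv q) < m"
    using Suc.prems(2) by (auto simp: degree_pderiv pderiv_eq_0_iff)
  then have IH: "integral {-1..1} (poly (?W * pderiv q)) = 0"
    by (intro Suc.IH) (use Suc.prems in auto)
  have "poly ((pderiv ^^ Suc m) ([:-1, 0, 1:] ^ n) * q)
      = (\<lambda>x. poly (pderiv (?W * q)) x - poly (?W * pderiv q) x)"
    by (auto simp: fun_eq_iff pderiv_mult algebra_simps)
  moreover have "integral {-1..1} (\<lambda>x. poly (pderiv (?W * q)) x - poly (?W * pderiv q) x)
      = integral {-1..1} (poly (pderiv (?W * q))) - integral {-1..1} (poly (?W * pderiv q))"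
    by (intro integral_diff poly_integrable)
  ultimately show ?case
    using IH boundary integral_unique[OF has_integral_pderiv[of "?W * q"]] by simp
qed

lemma degree_legendre_poly_le: "degree (legendre_poly n) \<le> n"
proof -
  have "degree ((pderiv ^^ m) p) = degree p - m" for m and p :: "real poly"
    by (induction m) (auto simp: degree_pderiv)
  moreover have "degree ([:-1, 0, 1:] ^ n :: real poly) \<le> 2 * n"
    using degree_power_le[of "[:-1, 0, 1:] :: real poly" n] by simp
  ultimately show ?thesis
    unfolding legendre_poly_def by (intro order.trans[OF degree_smult_le]) simp
qed

text \<open>Only the factor of higher degree is expanded by the Rodrigues formula; the other one
  serves as the test polynomial of degree below \<open>l\<close>.\<close>

lemma legendre_poly_orthogonal:
  assumes "k < l"
  shows "integral {-1..1} (\<lambda>x. poly (legendre_poly k) x * poly (legendre_poly l) x) = 0"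
proof -
  have "integral {-1..1} (poly ((pderiv ^^ l) ([:-1, 0, 1:] ^ l) * legendre_poly k)) = 0"
    using degree_legendre_poly_le[of k] assms
    by (intro integral_higher_pderiv_times_lower_degree) auto
  then have "integral {-1..1} (\<lambda>x. poly (legendre_poly k) x *
       poly ((pderiv ^^ l) ([:-1, 0, 1:] ^ l)) x) = 0"
    by (simp add: poly_mult [abs_def] mult.commute)
  then have "integral {-1..1} (\<lambda>x. 1 / (2 ^ l * fact l) * (poly (legendre_poly k) x *
       poly ((pderiv ^^ l) ([:-1, 0, 1:] ^ l)) x)) = 0"
    by (simp only: integral_mult_right mult_zero_right)
  moreover have "(\<lambda>x. poly (legendre_poly k) x * poly (legendre_poly l) x) =
     (\<lambda>x. 1 / (2 ^ l * fact l) * (poly (legendre_poly k) x *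
       poly ((pderiv ^^ l) ([:-1, 0, 1:] ^ l)) x))"
    unfolding legendre_poly_def [of l] by (simp add: fun_eq_iff)
  ultimately show ?thesis by simp
qed

lemma normalized_legendre_orthogonal:
  assumes "k \<noteq> l"
  shows "integral {-1..1} (\<lambda>x. poly (normalized_legendre k) x * poly (normalized_legendre l) x) = 0"
proof -
  define c where "c n = 1 / sqrt (integral {-1..1} (\<lambda>x. (poly (legendre_poly n) x)\<^sup>2))" for n
  have "(\<lambda>x. poly (normalized_legendre k) x * poly (normalized_legendre l) x) =
     (\<lambda>x. (c k * c l) * (poly (legendre_poly k) x * poly (legendre_poly l) x))"
    by (simp add: fun_eq_iff normalized_legendre_def c_def)
  moreover have "integral {-1..1} (\<lambda>x. poly (legendre_poly k) x * poly (legendre_poly l) x) = 0"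
    using legendre_poly_orthogonal[of k l] legendre_poly_orthogonal[of l k] assms
    by (cases "k < l") (simp_all add: mult.commute)
  ultimately show ?thesis by (simp only: integral_mult_right mult_zero_right)
qed

(* An inequality avoids showing that the normalizing constant does not vanish. *)
lemma normalized_legendre_norm_le:
  "integral {-1..1} (\<lambda>x. poly (normalized_legendre k) x * poly (normalized_legendre k) x) \<le> 1"
proof -
  define I where "I = integral {-1..1} (\<lambda>x. (poly (legendre_poly k) x)\<^sup>2)"
  have I: "I \<ge> 0" unfolding I_def by (rule integral_nonneg)
      (auto intro!: integrable_continuous_interval continuous_intros)
  have normalized: "normalized_legendre k = Polynomial.smult (1 / sqrt I) (legendre_poly k)"
    unfolding normalized_legendre_def I_def ..
  have "1 / I = 1 / sqrt I * (1 / sqrt I)" using I by simp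
  then have "(\<lambda>x. poly (normalized_legendre k) x * poly (normalized_legendre k) x) =
     (\<lambda>x. (1 / I) * (poly (legendre_poly k) x)\<^sup>2)"
    by (simp only: normalized poly_smult power2_eq_square mult_ac)
  then have "integral {-1..1} (\<lambda>x. poly (normalized_legendre k) x * poly (normalized_legendre k) x)
      = (1 / I) * I"
    by (simp only: integral_mult_right I_def)
  \<comment> \<open>The product is 1 if \<open>I\<close> is nonzero, and 0 otherwise since division
    by zero yields 0.\<close>
  then show ?thesis by simp
qed

lemma poly_sum_squared:
  fixes P :: "nat \<Rightarrow> real poly" and c :: "nat \<Rightarrow> real"
  shows "(poly (\<Sum>k<n. Polynomial.smult (c k) (P k)) x)\<^sup>2
    = (\<Sum>k<n. \<Sum>l<n. c k * c l * (poly (P k) x * poly (P l) x))"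
  by (simp add: power2_eq_square poly_sum sum_product mult_ac)

text \<open>With \<open>p\<close> the combination of the normalized polynomials with coefficients
  \<open>c\<close>, the form is the integral of x p(x)^2. As |x| <= 1, it is dominated by the
  integral of p(x)^2, where orthogonality leaves only the diagonal terms.\<close>

lemma abs_angular_quadratic_form_le:
  "\<bar>\<Sum>k<n. \<Sum>l<n. c k * c l * angular_matrix n $$ (k, l)\<bar> \<le> (\<Sum>k<n. (c k)\<^sup>2)"
proof -
  let ?P = normalized_legendre
  define p where "p = (\<Sum>k<n. Polynomial.smult (c k) (?P k))"
  have "(\<Sum>k<n. \<Sum>l<n. c k * c l * angular_matrix n $$ (k, l))
      = (\<Sum>k<n. \<Sum>l<n. integral {-1..1} (\<lambda>x. c k * c l * (x * poly (?P k) x * poly (?P l) x)))"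
    by (simp add: angular_matrix_def)
  also have "\<dots> = integral {-1..1}
       (\<lambda>x. \<Sum>k<n. \<Sum>l<n. c k * c l * (x * poly (?P k) x * poly (?P l) x))"
    by (subst integral_sum; (subst integral_sum)?)
       (auto intro!: integrable_continuous_interval continuous_intros)
  also have "\<dots> = integral {-1..1} (\<lambda>x. x * (poly p x)\<^sup>2)"
    unfolding p_def poly_sum_squared by (simp add: sum_distrib_left mult_ac)
  finally have form: "(\<Sum>k<n. \<Sum>l<n. c k * c l * angular_matrix n $$ (k, l))
      = integral {-1..1} (\<lambda>x. x * (poly p x)\<^sup>2)" .
  have "norm (integral {-1..1} (\<lambda>x. x * (poly p x)\<^sup>2)) \<le> integral {-1..1} (\<lambda>x. (poly p x)\<^sup>2)"
    by (rule integral_norm_bound_integral)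
       (auto simp: abs_mult abs_le_iff intro!: mult_left_le_one_le
          integrable_continuous_interval continuous_intros)
  also have "integral {-1..1} (\<lambda>x. (poly p x)\<^sup>2)
      = (\<Sum>k<n. \<Sum>l<n. c k * c l * integral {-1..1} (\<lambda>x. poly (?P k) x * poly (?P l) x))"
    unfolding p_def poly_sum_squared
    by (subst integral_sum; (subst integral_sum)?)
       (auto intro!: integrable_continuous_interval continuous_intros)
  also have "\<dots> = (\<Sum>k<n. (c k)\<^sup>2 * integral {-1..1} (\<lambda>x. poly (?P k) x * poly (?P k) x))"
  proof (rule sum.cong [OF refl])
    fix k assume "k \<in> {..<n}"
    have "(\<Sum>l<n. c k * c l * integral {-1..1} (\<lambda>x. poly (?P k) x * poly (?P l) x))
       = (\<Sum>l<n. if l = k then (c k)\<^sup>2 * integral {-1..1} (\<lambda>x. poly (?P k) x * poly (?P k) x) else 0)"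
      by (intro sum.cong) (auto simp: normalized_legendre_orthogonal power2_eq_square)
    with \<open>k \<in> {..<n}\<close> show "(\<Sum>l<n. c k * c l * integral {-1..1} (\<lambda>x. poly (?P k) x * poly (?P l) x))
       = (c k)\<^sup>2 * integral {-1..1} (\<lambda>x. poly (?P k) x * poly (?P k) x)"
      by simp
  qed
  also have "\<dots> \<le> (\<Sum>k<n. (c k)\<^sup>2)"
    by (intro sum_mono mult_left_le normalized_legendre_norm_le) simp
  finally show ?thesis by (simp add: form)
qed

section \<open>Periodic neighbours and the action of the stencils\<close>

definition next_idx :: "nat \<Rightarrow> nat \<Rightarrow> nat" where
  "next_idx N j = (if j = N then 1 else j + 1)"

definition prev_idx :: "nat \<Rightarrow> nat \<Rightarrow> nat" where
  "prev_idx N j = (if j = 1 then N else j - 1)"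

lemma sum_next_idx: "(\<Sum>j = 1..N. f (next_idx N j)) = (\<Sum>j = 1..N. f j)"
  by (rule sum.reindex_bij_witness[where i = "prev_idx N" and j = "next_idx N"])
     (auto simp: next_idx_def prev_idx_def)

lemma sum_prev_idx: "(\<Sum>j = 1..N. f (prev_idx N j)) = (\<Sum>j = 1..N. f j)"
  by (rule sum.reindex_bij_witness[where i = "next_idx N" and j = "prev_idx N"])
     (auto simp: next_idx_def prev_idx_def)

lemma mod_eq_next_idx:
  assumes "N \<ge> 3" "i \<in> {1..N}" "j \<in> {1..N}"
  shows "i mod N = (j + 1) mod N \<longleftrightarrow> i = next_idx N j"
proof -
  \<comment> \<open>Indices start at 1, so the last index \<open>N\<close> has residue 0: residue 0
    is reached from \<open>j = N - 1\<close> and residue 1 from \<open>j = N\<close>.\<close>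
  have "(j + 1) mod N = (if j = N then 1 else if j + 1 = N then 0 else j + 1)"
    using assms by (auto simp: mod_Suc)
  moreover have "i mod N = (if i = N then 0 else i)" using assms by simp
  ultimately show ?thesis using assms by (auto simp: next_idx_def)
qed

text \<open>The previous lemma with \<open>i\<close> and \<open>j\<close> exchanged, since the two
  neighbour maps are inverse to each other on the grid.\<close>

lemma mod_eq_prev_idx:
  assumes "N \<ge> 3" "i \<in> {1..N}" "j \<in> {1..N}"
  shows "(i + 1) mod N = j mod N \<longleftrightarrow> i = prev_idx N j"
  using mod_eq_next_idx[OF assms(1,3,2)] assms
  by (auto simp: next_idx_def prev_idx_def split: if_splits)

lemma neighbour_idx:
  assumes "N \<ge> 3" "j \<in> {1..N}"
  shows "next_idx N j \<in> {1..N}" "prev_idx N j \<in> {1..N}"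
    "next_idx N j \<noteq> j" "prev_idx N j \<noteq> j" "next_idx N j \<noteq> prev_idx N j"
  using assms by (auto simp: next_idx_def prev_idx_def)

lemma sum_stencil_x:
  assumes "N \<ge> 3" "j \<in> {1..N}"
  shows "(\<Sum>i = 1..N. stencil_x N h j i * f i)
    = (f (next_idx N j) - f (prev_idx N j)) / (2 * h)"
proof -
  note idx = neighbour_idx[OF assms]
  \<comment> \<open>The two neighbours differ because \<open>N \<ge> 3\<close>, so the nested
    conditional splits into a sum of two indicator terms.\<close>
  have "stencil_x N h j i * f i = (if i = next_idx N j then f i / (2 * h) else 0)
      + (if i = prev_idx N j then - f i / (2 * h) else 0)" if "i \<in> {1..N}" for i
    unfolding stencil_x_def mod_eq_next_idx[OF assms(1) that assms(2)]
      mod_eq_prev_idx[OF assms(1) that assms(2)]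
    using idx(5) by simp
  then have "(\<Sum>i = 1..N. stencil_x N h j i * f i)
    = (\<Sum>i = 1..N. (if i = next_idx N j then f i / (2 * h) else 0)
        + (if i = prev_idx N j then - f i / (2 * h) else 0))"
    by (rule sum.cong [OF refl])
  also have "\<dots> = f (next_idx N j) / (2 * h) + - f (prev_idx N j) / (2 * h)"
    using idx(1,2) by (simp only: sum.distrib sum.delta finite_atLeastAtMost if_True)
  finally show ?thesis by (simp add: diff_divide_distrib)
qed

lemma sum_stencil_xx:
  assumes "N \<ge> 3" "j \<in> {1..N}"
  shows "(\<Sum>i = 1..N. stencil_xx N h j i * f i)
    = (f (next_idx N j) - 2 * f j + f (prev_idx N j)) / (2 * h)"
proof -
  note idx = neighbour_idx[OF assms]
  have "stencil_xx N h j i * f i = (if i = next_idx N j then f i / (2 * h) else 0)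
      + (if i = prev_idx N j then f i / (2 * h) else 0) + (if i = j then - f i / h else 0)"
    if "i \<in> {1..N}" for i
    unfolding stencil_xx_def mod_eq_next_idx[OF assms(1) that assms(2)]
      mod_eq_prev_idx[OF assms(1) that assms(2)]
    using idx(3-5) by auto
  then have "(\<Sum>i = 1..N. stencil_xx N h j i * f i)
    = (\<Sum>i = 1..N. (if i = next_idx N j then f i / (2 * h) else 0)
        + (if i = prev_idx N j then f i / (2 * h) else 0) + (if i = j then - f i / h else 0))"
    by (rule sum.cong [OF refl])
  also have "\<dots> = f (next_idx N j) / (2 * h) + f (prev_idx N j) / (2 * h) + - f j / h"
    using idx(1,2) assms(2) by (simp only: sum.distrib sum.delta finite_atLeastAtMost if_True)
  finally show ?thesis by (simp add: diff_divide_distrib add_divide_distrib)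
qed

section \<open>Scalar upwind transport\<close>

lemma square_convex_combination_le:
  fixes x y z :: real
  assumes "a \<ge> 0" "b \<ge> 0" "c \<ge> 0" "a + b + c = 1"
  shows "(a * x + b * y + c * z)\<^sup>2 \<le> a * x\<^sup>2 + b * y\<^sup>2 + c * z\<^sup>2"
proof -
  have a: "a = 1 - b - c" using assms by simp
  \<comment> \<open>The gap in Jensen's inequality for the square is a weighted sum of squared
    differences.\<close>
  have "a * x\<^sup>2 + b * y\<^sup>2 + c * z\<^sup>2 - (a * x + b * y + c * z)\<^sup>2
      = a * b * (x - y)\<^sup>2 + a * c * (x - z)\<^sup>2 + b * c * (y - z)\<^sup>2"
    unfolding a by (simp add: power2_eq_square algebra_simps)
  also have "\<dots> \<ge> 0" using assms by (intro add_nonneg_nonneg mult_nonneg_nonneg) auto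
  finally show ?thesis by simp
qed

text \<open>One step of scalar advection with signed Courant number \<open>a\<close>. The second
  difference turns the central difference into a one-sided one: for \<open>a \<ge> 0\<close> the
  value is (1 - a) z_j + a z_(j-1), and for \<open>a \<le> 0\<close> the right neighbour takes
  over.\<close>

definition upwind :: "nat \<Rightarrow> real \<Rightarrow> (nat \<Rightarrow> real) \<Rightarrow> nat \<Rightarrow> real" where
  "upwind N a z j = z j - a / 2 * (z (next_idx N j) - z (prev_idx N j))
     + \<bar>a\<bar> / 2 * (z (next_idx N j) - 2 * z j + z (prev_idx N j))"

lemma sum_upwind_squared_le:
  assumes "\<bar>a\<bar> \<le> 1"
  shows "(\<Sum>j = 1..N. (upwind N a z j)\<^sup>2) \<le> (\<Sum>j = 1..N. (z j)\<^sup>2)"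
proof -
  \<comment> \<open>The weights of the right and the left neighbour; the sign of \<open>a\<close>
    decides which of them is zero.\<close>
  define b c where "b = (\<bar>a\<bar> - a) / 2" and "c = (\<bar>a\<bar> + a) / 2"
  have bc: "b \<ge> 0" "c \<ge> 0" "1 - \<bar>a\<bar> + b + c = 1" unfolding b_def c_def by (auto simp: field_simps)
  have "(\<Sum>j = 1..N. (upwind N a z j)\<^sup>2)
     = (\<Sum>j = 1..N. ((1 - \<bar>a\<bar>) * z j + b * z (next_idx N j) + c * z (prev_idx N j))\<^sup>2)"
    unfolding upwind_def b_def c_def by (simp add: field_simps)
  also have "\<dots> \<le> (\<Sum>j = 1..N. (1 - \<bar>a\<bar>) * (z j)\<^sup>2 + b * (z (next_idx N j))\<^sup>2
      + c * (z (prev_idx N j))\<^sup>2)"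
    using bc assms by (intro sum_mono square_convex_combination_le) auto
  \<comment> \<open>Shifts permute the periodic grid, so all three sums of squares coincide.\<close>
  also have "\<dots> = (1 - \<bar>a\<bar> + b + c) * (\<Sum>j = 1..N. (z j)\<^sup>2)"
    using sum_next_idx[of "\<lambda>i. (z i)\<^sup>2" N] sum_prev_idx[of "\<lambda>i. (z i)\<^sup>2" N]
    by (simp add: sum.distrib sum_distrib_left [symmetric] distrib_right)
  finally show ?thesis using bc(3) by simp
qed

section \<open>Orthogonal diagonalization and the implicit source step\<close>

lemma parseval:
  fixes q :: "nat \<Rightarrow> nat \<Rightarrow> real"
  assumes "\<And>m m'. m < n \<Longrightarrow> m' < n \<Longrightarrow> (\<Sum>k<n. q k m * q k m') = (if m = m' then 1 else 0)"
  shows "(\<Sum>k<n. (\<Sum>m<n. q k m * y m)\<^sup>2) = (\<Sum>m<n. (y m)\<^sup>2)"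
proof -
  have "(\<Sum>k<n. (\<Sum>m<n. q k m * y m)\<^sup>2) = (\<Sum>k<n. \<Sum>m<n. \<Sum>m'<n. y m * y m' * (q k m * q k m'))"
    by (simp add: power2_eq_square sum_product mult_ac)
  also have "\<dots> = (\<Sum>m<n. \<Sum>m'<n. y m * y m' * (\<Sum>k<n. q k m * q k m'))"
    by (subst sum.swap, rule sum.cong [OF refl], subst sum.swap) (simp add: sum_distrib_left)
  also have "\<dots> = (\<Sum>m<n. \<Sum>m'<n. if m' = m then (y m)\<^sup>2 else 0)"
    by (intro sum.cong) (auto simp: assms power2_eq_square)
  finally show ?thesis by simp
qed

lemma index_conjugated_diagonal:
  fixes Q D :: "real mat"
  assumes "Q \<in> carrier_mat n n" "D \<in> carrier_mat n n" "diagonal_mat D" "k < n" "l < n"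
  shows "(Q * D * transpose_mat Q) $$ (k, l) = (\<Sum>m<n. Q $$ (k, m) * D $$ (m, m) * Q $$ (l, m))"
proof -
  have "(Q * D) $$ (k, m) = Q $$ (k, m) * D $$ (m, m)" if "m < n" for m
  proof -
    have "(Q * D) $$ (k, m) = (\<Sum>i<n. Q $$ (k, i) * D $$ (i, m))"
      using assms that by (simp add: scalar_prod_def atLeast0LessThan)
    also have "\<dots> = (\<Sum>i<n. if i = m then Q $$ (k, m) * D $$ (m, m) else 0)"
      using assms(2,3) that by (intro sum.cong) (auto simp: diagonal_mat_def)
    finally show ?thesis using that by simp
  qed
  then show ?thesis using assms
    by (simp add: scalar_prod_def atLeast0LessThan del: assoc_mult_mat)
qed

text \<open>Applying Q diag(a) Q^T to \<open>x\<close> means passing to eigenbasis coefficients,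
  scaling them and transforming back. It serves for the eigenvalues, for their absolute values, and
  for the constant 1, which recovers a vector from its coefficients.\<close>

lemma sum_symmetric_spectral_form:
  fixes q :: "nat \<Rightarrow> nat \<Rightarrow> real"
  shows "(\<Sum>l<n. x l * (\<Sum>m<n. q k m * a m * q l m)) = (\<Sum>m<n. q k m * (a m * (\<Sum>l<n. q l m * x l)))"
  by (subst sum_distrib_left, subst sum.swap) (simp add: sum_distrib_left mult_ac)

(* Testing the implicit step against (x, b), both source terms combine to
   - s * (y - sqrt 2 * b)^2, where y is the component x 0. *)
lemma implicit_source_dissipation:
  fixes x w :: "nat \<Rightarrow> real"
  assumes "n \<ge> 1" "s \<ge> 0"
    and x: "\<And>k. k < n \<Longrightarrow> x k = w k + s * (sqrt 2 * (if k = 0 then b else 0) - x k)"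
    and b: "b = b0 + s * (sqrt 2 * x 0 - 2 * b)"
  shows "(\<Sum>k<n. (x k)\<^sup>2) + b\<^sup>2 \<le> (\<Sum>k<n. (w k)\<^sup>2) + b0\<^sup>2"
proof -
  \<comment> \<open>The energy identity of implicit Euler: dropping the negative square bounds the
    new energy by the old one plus twice the increment tested against the new value.\<close>
  have eq: "y\<^sup>2 = w'\<^sup>2 - (y - w')\<^sup>2 + 2 * y * (y - w')" for y w' :: real
    by (simp add: power2_eq_square algebra_simps)
  \<comment> \<open>The source contribution of the component 0. Every other component contributes -2
    s (x k)^2, which is nonpositive and is dropped.\<close>
  let ?r = "2 * s * (sqrt 2 * b * x 0 - (x 0)\<^sup>2)"
  have "(x k)\<^sup>2 \<le> (w k)\<^sup>2 + (if k = 0 then ?r else 0)" if "k < n" for k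
  proof -
    have "x k - w k = s * (sqrt 2 * (if k = 0 then b else 0) - x k)" using x[OF that] by linarith
    then have "(x k)\<^sup>2 \<le> (w k)\<^sup>2 + 2 * x k * (s * (sqrt 2 * (if k = 0 then b else 0) - x k))"
      using eq[of "x k" "w k"] by (smt (verit) zero_le_power2)
    moreover have "2 * x k * (s * (sqrt 2 * (if k = 0 then b else 0) - x k))
        \<le> (if k = 0 then ?r else 0)"
      using assms(2) by (auto simp: power2_eq_square algebra_simps)
    ultimately show ?thesis by linarith
  qed
  then have "(\<Sum>k<n. (x k)\<^sup>2) \<le> (\<Sum>k<n. (w k)\<^sup>2 + (if k = 0 then ?r else 0))"
    by (intro sum_mono) auto
  also have "\<dots> = (\<Sum>k<n. (w k)\<^sup>2) + ?r"
    using assms(1) by (simp add: sum.distrib)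
  finally have 1: "(\<Sum>k<n. (x k)\<^sup>2) \<le> (\<Sum>k<n. (w k)\<^sup>2) + ?r" .
  have "b - b0 = s * (sqrt 2 * x 0 - 2 * b)" using b by linarith
  then have 2: "b\<^sup>2 \<le> b0\<^sup>2 + 2 * b * (s * (sqrt 2 * x 0 - 2 * b))"
    using eq[of b b0] by (smt (verit) zero_le_power2)
  have "?r + 2 * b * (s * (sqrt 2 * x 0 - 2 * b))
      = - 2 * s * (x 0 - sqrt 2 * b)\<^sup>2"
    by (simp add: power2_eq_square algebra_simps)
  also have "\<dots> \<le> 0" using assms(2) by simp
  finally show ?thesis using 1 2 by linarith
qed

section \<open>Energy estimate for the full scheme\<close>

theorem theorem2:
  fixes Nx N\<mu> :: nat and \<Delta>x \<Delta>t \<sigma> :: real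
    and v0 v1 :: "nat \<Rightarrow> nat \<Rightarrow> real" and B0 B1 :: "nat \<Rightarrow> real"
    and A absA Q M :: "real mat"
  assumes Nx: "Nx \<ge> 3" and N\<mu>: "N\<mu> \<ge> 1"
    and dx: "\<Delta>x = 1 / real Nx" and dt: "\<Delta>t > 0" and sigma: "\<sigma> \<ge> 0"
    and A: "A = angular_matrix N\<mu>"
    and Q_carrier: "Q \<in> carrier_mat N\<mu> N\<mu>"
    and Q_orthogonal: "Q * transpose_mat Q = 1\<^sub>m N\<mu>" "transpose_mat Q * Q = 1\<^sub>m N\<mu>"
    and M_carrier: "M \<in> carrier_mat N\<mu> N\<mu>" and M_diagonal: "diagonal_mat M"
    and A_diagonalization: "A = Q * M * transpose_mat Q"
    and absA: "absA = Q * map_mat abs M * transpose_mat Q"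
    and B0_nonzero: "\<And>j. j \<in> {1..Nx} \<Longrightarrow> B0 j \<noteq> 0"
    and scheme_v: "\<And>j k. j \<in> {1..Nx} \<Longrightarrow> k < N\<mu> \<Longrightarrow>
      v1 j k = v0 j k
        - \<Delta>t * (\<Sum>i = 1..Nx. \<Sum>l<N\<mu>.
            1 / B0 j * stencil_x Nx \<Delta>x j i * B0 i * v0 i l * A $$ (k, l))
        + \<Delta>t * (\<Sum>i = 1..Nx. \<Sum>l<N\<mu>.
            1 / B0 j * stencil_xx Nx \<Delta>x j i * B0 i * v0 i l * absA $$ (k, l))
        + \<sigma> * \<Delta>t * (B1 j / B0 j) * (sqrt 2 * (if k = 0 then 1 else 0) - v1 j k)
        - \<Delta>t * (1 / B0 j) * ((B1 j - B0 j) / \<Delta>t) * v1 j k"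
    and scheme_B: "\<And>j. j \<in> {1..Nx} \<Longrightarrow>
      B1 j = B0 j + \<sigma> * \<Delta>t * B1 j * (sqrt 2 * v1 j 0 - 2)"
    and time_step: "\<Delta>t \<le> \<Delta>x"
  shows "energy Nx N\<mu> v1 B1 \<le> energy Nx N\<mu> v0 B0"
proof -
  define q where "q k m = Q $$ (k, m)" for k m
  define a where "a m = M $$ (m, m)" for m
  define \<nu> where "\<nu> = \<Delta>t / \<Delta>x"
  define u where "u j k = B0 j * v0 j k" for j k
  \<comment> \<open>\<open>z m\<close> is the grid function of the m-th eigenbasis coefficient of
    \<open>u\<close>; \<open>w\<close> is the state after transport and before the source
    step.\<close>
  define z where "z m j = (\<Sum>l<N\<mu>. q l m * u j l)" for m j
  define w where "w j k = (\<Sum>m<N\<mu>. q k m * upwind Nx (\<nu> * a m) (z m) j)" for j k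
  have dx_pos: "\<Delta>x > 0" using dx Nx by simp
  have nu: "0 \<le> \<nu>" "\<nu> \<le> 1" using dt time_step dx_pos by (auto simp: \<nu>_def)
  have col: "(\<Sum>k<N\<mu>. q k m * q k m') = (if m = m' then 1 else 0)" if "m < N\<mu>" "m' < N\<mu>" for m m'
    using arg_cong[OF Q_orthogonal(2), of "\<lambda>X. X $$ (m, m')"] Q_carrier that
    by (simp add: scalar_prod_def atLeast0LessThan q_def)
  have row: "(\<Sum>m<N\<mu>. q k m * q l m) = (if k = l then 1 else 0)" if "k < N\<mu>" "l < N\<mu>" for k l
    using arg_cong[OF Q_orthogonal(1), of "\<lambda>X. X $$ (k, l)"] Q_carrier that
    by (simp add: scalar_prod_def atLeast0LessThan q_def)
  have A_entry: "A $$ (k, l) = (\<Sum>m<N\<mu>. q k m * a m * q l m)" if "k < N\<mu>" "l < N\<mu>" for k l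
    unfolding A_diagonalization q_def a_def
    by (rule index_conjugated_diagonal[OF Q_carrier M_carrier M_diagonal that])
  have absA_entry: "absA $$ (k, l) = (\<Sum>m<N\<mu>. q k m * \<bar>a m\<bar> * q l m)" if "k < N\<mu>" "l < N\<mu>" for k l
  proof -
    have "map_mat abs M \<in> carrier_mat N\<mu> N\<mu>" "diagonal_mat (map_mat abs M)"
      using M_carrier M_diagonal by (auto simp: diagonal_mat_def)
    from index_conjugated_diagonal[OF Q_carrier this that] show ?thesis
      unfolding absA q_def a_def using M_carrier by simp
  qed
  have abs_a: "\<bar>a m\<bar> \<le> 1" if "m < N\<mu>" for m
  proof -
    \<comment> \<open>The m-th column of \<open>Q\<close> is a unit eigenvector, so the quadratic
      form evaluated there is the eigenvalue \<open>a m\<close>.\<close>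
    have "(\<Sum>k<N\<mu>. \<Sum>l<N\<mu>. q k m * q l m * A $$ (k, l))
       = (\<Sum>k<N\<mu>. q k m * (\<Sum>l<N\<mu>. q l m * (\<Sum>m'<N\<mu>. q k m' * a m' * q l m')))"
      by (simp add: A_entry sum_distrib_left mult.assoc)
    also have "\<dots> = (\<Sum>k<N\<mu>. q k m * (\<Sum>m'<N\<mu>. q k m' * (a m' * (\<Sum>l<N\<mu>. q l m' * q l m))))"
      by (simp only: sum_symmetric_spectral_form[of "\<lambda>l. q l m" q _ a])
    also have "\<dots> = (\<Sum>k<N\<mu>. q k m * q k m * a m)"
      using that by (simp add: col if_distrib mult.assoc cong: if_cong)
    also have "\<dots> = a m"
      using that by (simp add: sum_distrib_right [symmetric] col)
    finally have "(\<Sum>k<N\<mu>. \<Sum>l<N\<mu>. q k m * q l m * A $$ (k, l)) = a m" .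
    moreover have "(\<Sum>k<N\<mu>. (q k m)\<^sup>2) = 1"
      using col[OF that that] by (simp add: power2_eq_square)
    ultimately show ?thesis
      using abs_angular_quadratic_form_le[of "\<lambda>k. q k m" N\<mu>] A by simp
  qed
  have u_z: "u j k = (\<Sum>m<N\<mu>. q k m * z m j)" if "k < N\<mu>" for j k
  proof -
    have "(\<Sum>m<N\<mu>. q k m * z m j) = (\<Sum>l<N\<mu>. u j l * (\<Sum>m<N\<mu>. q k m * q l m))"
      unfolding z_def using sum_symmetric_spectral_form[of "u j" q k "\<lambda>_. 1" N\<mu>] by simp
    also have "\<dots> = u j k"
      using that by (simp add: row if_distrib cong: if_cong)
    finally show ?thesis by simp
  qed
  have u_A: "(\<Sum>l<N\<mu>. u i l * A $$ (k, l)) = (\<Sum>m<N\<mu>. q k m * (a m * z m i))" if "k < N\<mu>" for i k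
    unfolding z_def using that by (simp add: A_entry sum_symmetric_spectral_form[of "u i" q k a])
  have u_absA: "(\<Sum>l<N\<mu>. u i l * absA $$ (k, l)) = (\<Sum>m<N\<mu>. q k m * (\<bar>a m\<bar> * z m i))"
    if "k < N\<mu>" for i k
    unfolding z_def using that by (simp add: absA_entry sum_symmetric_spectral_form[of "u i" q k "\<lambda>m. \<bar>a m\<bar>"])
  have transport: "w j k = u j k
      - \<Delta>t * (\<Sum>i = 1..Nx. stencil_x Nx \<Delta>x j i * (\<Sum>l<N\<mu>. u i l * A $$ (k, l)))
      + \<Delta>t * (\<Sum>i = 1..Nx. stencil_xx Nx \<Delta>x j i * (\<Sum>l<N\<mu>. u i l * absA $$ (k, l)))"
    if "j \<in> {1..Nx}" "k < N\<mu>" for j k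
  proof -
    have cfl: "\<Delta>t * (X / (2 * \<Delta>x)) = \<nu> / 2 * X" for X by (simp add: \<nu>_def)
    \<comment> \<open>Since \<nu> is nonnegative, scaling the eigenvalues by it commutes with taking
      absolute values, so the \<open>absA\<close> term is exactly the dissipation in
      \<open>upwind\<close>.\<close>
    have abs_nu: "\<bar>\<nu> * a m\<bar> = \<nu> * \<bar>a m\<bar>" for m using nu by (simp add: abs_mult)
    show ?thesis
      unfolding sum_stencil_x[OF Nx that(1)] sum_stencil_xx[OF Nx that(1)] cfl
        u_A[OF that(2)] u_absA[OF that(2)] u_z[OF that(2)] w_def upwind_def abs_nu
      by (simp add: algebra_simps sum.distrib sum_subtractf sum_distrib_left sum_divide_distrib)
  qed
  have source: "(\<Sum>k<N\<mu>. (B1 j * v1 j k)\<^sup>2) + (B1 j)\<^sup>2 \<le> (\<Sum>k<N\<mu>. (w j k)\<^sup>2) + (B0 j)\<^sup>2"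
    if j: "j \<in> {1..Nx}" for j
  proof (rule implicit_source_dissipation[where s = "\<sigma> * \<Delta>t"])
    show "B1 j = B0 j + \<sigma> * \<Delta>t * (sqrt 2 * (B1 j * v1 j 0) - 2 * B1 j)"
      using scheme_B[OF j] by (simp add: algebra_simps)
    fix k assume k: "k < N\<mu>"
    \<comment> \<open>Multiplying the scheme by \<open>B0 j\<close> clears the division and leaves
      the stencil acting on the conservative variable \<open>u\<close>.\<close>
    have pull: "B0 j * (\<Sum>i = 1..Nx. \<Sum>l<N\<mu>. 1 / B0 j * S j i * B0 i * v0 i l * X $$ (k, l))
        = (\<Sum>i = 1..Nx. S j i * (\<Sum>l<N\<mu>. u i l * X $$ (k, l)))" for S and X :: "real mat"
      using B0_nonzero[OF j] by (simp add: sum_distrib_left u_def mult_ac)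
    have cancel: "B0 j * (\<sigma> * \<Delta>t * (B1 j / B0 j) * r) = \<sigma> * \<Delta>t * (B1 j * r)"
      "B0 j * (\<Delta>t * (1 / B0 j) * ((B1 j - B0 j) / \<Delta>t) * r) = (B1 j - B0 j) * r" for r
      using B0_nonzero[OF j] dt by simp_all
    have "B0 j * v1 j k = w j k + \<sigma> * \<Delta>t * (B1 j * (sqrt 2 * (if k = 0 then 1 else 0) - v1 j k))
        - (B1 j - B0 j) * v1 j k"
      unfolding transport[OF j k] pull[symmetric] cancel[symmetric]
      by (subst scheme_v[OF j k]) (simp only: u_def ring_distribs mult.left_commute [of "B0 j" \<Delta>t])
    \<comment> \<open>Moving \<open>(B1 j - B0 j) * v1 j k\<close> to the left turns
      \<open>B0 j * v1 j k\<close> into the new conservative variable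
      \<open>B1 j * v1 j k\<close>.\<close>
    then show "B1 j * v1 j k = w j k
        + \<sigma> * \<Delta>t * (sqrt 2 * (if k = 0 then B1 j else 0) - B1 j * v1 j k)"
      by (auto simp: algebra_simps)
  qed (use N\<mu> sigma dt in auto)
  have "(\<Sum>j = 1..Nx. \<Sum>k<N\<mu>. (w j k)\<^sup>2)
      = (\<Sum>m<N\<mu>. \<Sum>j = 1..Nx. (upwind Nx (\<nu> * a m) (z m) j)\<^sup>2)"
    unfolding w_def by (subst sum.swap) (simp add: parseval[OF col])
  also have "\<dots> \<le> (\<Sum>m<N\<mu>. \<Sum>j = 1..Nx. (z m j)\<^sup>2)"
    \<comment> \<open>The time step restriction enters here: \<nu> <= 1 and |a m| <= 1 bound each
      modal Courant number by 1.\<close>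
    using nu abs_a by (intro sum_mono sum_upwind_squared_le) (auto simp: abs_mult intro!: mult_le_one)
  also have "\<dots> = (\<Sum>j = 1..Nx. \<Sum>k<N\<mu>. (u j k)\<^sup>2)"
    by (subst sum.swap) (simp add: u_z parseval[OF col])
  finally have "(\<Sum>j = 1..Nx. \<Sum>k<N\<mu>. (w j k)\<^sup>2) \<le> (\<Sum>j = 1..Nx. \<Sum>k<N\<mu>. (B0 j * v0 j k)\<^sup>2)"
    by (simp add: u_def)
  moreover have "(\<Sum>j = 1..Nx. (\<Sum>k<N\<mu>. (B1 j * v1 j k)\<^sup>2) + (B1 j)\<^sup>2)
      \<le> (\<Sum>j = 1..Nx. (\<Sum>k<N\<mu>. (w j k)\<^sup>2) + (B0 j)\<^sup>2)"
    by (intro sum_mono source)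
  ultimately show ?thesis
    unfolding energy_def by (simp add: sum.distrib)
qed

end
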